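(* The involution monoid $(\mathsf{baxt}_3,{}^{\sharp})$ is non-finitely based.
   Context: Baxter monoid: for $n\ge 1$ let $\mathcal{A}_n=\{1<2<\cdots<n\}$ and let $\mathcal{A}_n^{\star}$ be the free monoid on $\mathcal{A}_n$. Then $\mathsf{baxt}_n=\mathcal{A}_n^{\star}/\!\equiv$, where $\equiv$ is the congruence generated by all pairs $(c\mathbf{u}ad\mathbf{v}b,\ c\mathbf{u}da\mathbf{v}b)$ with $a\le b<c\le d$ and $(b\mathbf{u}da\mathbf{v}c,\ b\mathbf{u}ad\mathbf{v}c)$ with $a<b\le c<d$, where $a,b,c,d\in\mathcal{A}_n$, $\mathbf{u},\mathbf{v}\in\mathcal{A}_n^{\star}$. Schützenberger's involution $^{\sharp}$ on $\mathsf{baxt}_n$ is induced by $i^{\sharp}=n+1-i$ and $(w_1\cdots w_k)^{\sharp}=w_k^{\sharp}\cdots w_1^{\sharp}$. Terms and identities: $\mathcal{X}$ is a countably infinite alphabet. $\mathsf{T}(\mathcal{X})$ is the smallest set containing $\mathcal{X}$ and the empty term $\emptyset$ and closed under (associative) concatenation and $^*$; the empty term is neutral for concatenation, $\emptyset^*=\emptyset$, and it is evaluated as the unit element. An identity is an expression $\mathbf{s}\approx\mathbf{t}$ with $\mathbf{s},\mathbf{t}$ nonempty terms; an involution monoid $(M,{}^* )$ satisfies it if every substitution $\mathcal{X}\to M$ gives both sides the same value. $\mathbf{s}\approx\mathbf{t}$ is directly deducible from $\mathbf{p}\approx\mathbf{q}$ if for some substitution $\varphi:\mathcal{X}\to\mathsf{T}(\mathcal{X})$,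 $\varphi(\mathbf{p})$ is a subterm of $\mathbf{s}$ and replacing this subterm by $\varphi(\mathbf{q})$ gives $\mathbf{t}$; it is deducible from a set $\Sigma$ if there is a finite sequence of terms from $\mathbf{s}$ to $\mathbf{t}$ in which each consecutive pair is directly deducible from an identity of $\Sigma$ (used in either direction). An identity basis for $(M,{}^* )$ is a set $\Sigma$ of identities of $(M,{}^* )$ from which every identity satisfied by $(M,{}^* )$ is deducible. $(M,{}^* )$ is finitely based if it has a finite identity basis, and non-finitely based otherwise. *)

theory Defs
  imports "HOL-Algebra.Group"
begin

section \<open>Involution monoids\<close>

locale involution_monoid = monoid M for M (structure) +
  fixes star :: "'a \<Rightarrow> 'a"
  assumes star_closed: "x \<in> carrier M \<Longrightarrow> star x \<in> carrier M"
    and star_star: "x \<in> carrier M \<Longrightarrow> star (star x) = x"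
    and star_mult: "x \<in> carrier M \<Longrightarrow> y \<in> carrier M \<Longrightarrow> star (x \<otimes> y) = star y \<otimes> star x"


section \<open>Terms\<close>

text \<open>
  The alphabet of variables is \<open>nat\<close>. Terms are considered up to associativity of
  concatenation, neutrality of the empty term and \<open>\<emptyset>\<^sup>* = \<emptyset>\<close>, but up to nothing else;
  in particular \<open>(xy)\<^sup>*\<close> and \<open>y\<^sup>*x\<^sup>*\<close> are different terms, as are \<open>x\<^sup>*\<^sup>*\<close> and \<open>x\<close>. So a
  term is uniquely a list of factors, each of which is a variable or the star of a nonempty
  term; \<open>Star f fs\<close> stands for the star of the nonempty term \<open>f # fs\<close>.
  Concatenation of terms is \<open>@\<close>, and the empty term is \<open>[]\<close>.
\<close>

datatype factor = Var nat | Star factor "factor list"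

type_synonym trm = "factor list"

fun star_trm :: "trm \<Rightarrow> trm" where
  "star_trm [] = []"
| "star_trm (f # fs) = [Star f fs]"

lemma trm_induct:
  assumes empty: "P []"
    and var: "\<And>x. P [Var x]"
    and cat: "\<And>s t. P s \<Longrightarrow> P t \<Longrightarrow> P (s @ t)"
    and star: "\<And>t. P t \<Longrightarrow> P (star_trm t)"
  shows "P t"
proof -
  have list: "P fs" if "\<And>f. f \<in> set fs \<Longrightarrow> P [f]" for fs
    using that
  proof (induction fs)
    case Nil
    show ?case by (rule empty)
  next
    case (Cons f fs)
    then show ?case using cat[of "[f]" fs] by simp
  qed
  have "P [f]" for f
  proof (induction f)
    case (Var x)
    then show ?case by (rule var)
  next
    case (Star f fs)
    have "P fs" using Star.IH(2) by (rule list)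
    then have "P (f # fs)" using cat[of "[f]" fs] Star.IH(1) by simp
    then show ?case using star[of "f # fs"] by simp
  qed
  then show ?thesis by (rule list)
qed

primrec eval_factor :: "('a, 'b) monoid_scheme \<Rightarrow> ('a \<Rightarrow> 'a) \<Rightarrow> (nat \<Rightarrow> 'a) \<Rightarrow> factor \<Rightarrow> 'a" where
  "eval_factor M star \<theta> (Var x) = \<theta> x"
| "eval_factor M star \<theta> (Star f fs) =
     star (eval_factor M star \<theta> f \<otimes>\<^bsub>M\<^esub>
           foldr (\<otimes>\<^bsub>M\<^esub>) (map (eval_factor M star \<theta>) fs) \<one>\<^bsub>M\<^esub>)"

definition eval_trm :: "('a, 'b) monoid_scheme \<Rightarrow> ('a \<Rightarrow> 'a) \<Rightarrow> (nat \<Rightarrow> 'a) \<Rightarrow> trm \<Rightarrow> 'a" where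
  "eval_trm M star \<theta> t = foldr (\<otimes>\<^bsub>M\<^esub>) (map (eval_factor M star \<theta>) t) \<one>\<^bsub>M\<^esub>"

primrec subst_factor :: "(nat \<Rightarrow> trm) \<Rightarrow> factor \<Rightarrow> trm" where
  "subst_factor \<phi> (Var x) = \<phi> x"
| "subst_factor \<phi> (Star f fs) =
     star_trm (subst_factor \<phi> f @ concat (map (subst_factor \<phi>) fs))"

definition subst_trm :: "(nat \<Rightarrow> trm) \<Rightarrow> trm \<Rightarrow> trm" where
  "subst_trm \<phi> t = concat (map (subst_factor \<phi>) t)"

lemma subst_trm_simps:
  "subst_trm \<phi> [] = []"
  "subst_trm \<phi> [Var x] = \<phi> x"
  "subst_trm \<phi> (s @ t) = subst_trm \<phi> s @ subst_trm \<phi> t"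
  "subst_trm \<phi> (star_trm t) = star_trm (subst_trm \<phi> t)"
  by (simp_all add: subst_trm_def) (cases t; simp)

context involution_monoid
begin

lemma star_one: "star \<one> = \<one>"
proof -
  have "star \<one> = star \<one> \<otimes> star (star \<one>)"
    by (simp add: star_closed star_star)
  also have "\<dots> = star (star \<one> \<otimes> \<one>)"
    by (rule star_mult[symmetric]) (simp_all add: star_closed)
  also have "\<dots> = \<one>"
    by (simp add: star_closed star_star)
  finally show ?thesis .
qed

lemma eval_factor_closed:
  assumes "range \<theta> \<subseteq> carrier M"
  shows "eval_factor M star \<theta> f \<in> carrier M"
proof (induction f)
  case (Var x)
  then show ?case using assms by auto
next
  case (Star f fs)
  have "foldr (\<otimes>) (map (eval_factor M star \<theta>) fs) \<one> \<in> carrier M"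
    using Star.IH(2) by (induction fs) auto
  then show ?case using Star.IH(1) by (simp add: star_closed)
qed

lemma eval_trm_closed: "range \<theta> \<subseteq> carrier M \<Longrightarrow> eval_trm M star \<theta> t \<in> carrier M"
  by (induction t) (auto simp: eval_trm_def intro: eval_factor_closed)

lemma eval_trm_simps:
  assumes "range \<theta> \<subseteq> carrier M"
  shows "eval_trm M star \<theta> [] = \<one>"
    and "eval_trm M star \<theta> [Var x] = \<theta> x"
    and "eval_trm M star \<theta> (s @ t) = eval_trm M star \<theta> s \<otimes> eval_trm M star \<theta> t"
    and "eval_trm M star \<theta> (star_trm t) = star (eval_trm M star \<theta> t)"
proof -
  show "eval_trm M star \<theta> [] = \<one>" by (simp add: eval_trm_def)
  show "eval_trm M star \<theta> [Var x] = \<theta> x"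
    using eval_factor_closed[OF assms, of "Var x"] by (simp add: eval_trm_def)
  show "eval_trm M star \<theta> (s @ t) = eval_trm M star \<theta> s \<otimes> eval_trm M star \<theta> t"
  proof (induction s)
    case Nil
    then show ?case using eval_trm_closed[OF assms, of t] by (simp add: eval_trm_def)
  next
    case (Cons f s)
    then show ?case
      using eval_trm_closed[OF assms, of t] eval_trm_closed[OF assms, of s]
        eval_factor_closed[OF assms, of f]
      by (simp add: eval_trm_def m_assoc)
  qed
  show "eval_trm M star \<theta> (star_trm t) = star (eval_trm M star \<theta> t)"
  proof (cases t)
    case Nil
    then show ?thesis by (simp add: eval_trm_def star_one)
  next
    case (Cons f fs)
    then show ?thesis
      using eval_factor_closed[OF assms, of "Star f fs"] by (simp add: eval_trm_def)
  qed
qed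

end


section \<open>Identities and deduction\<close>

text \<open>The pair \<open>(s, t)\<close> stands for the identity \<open>s \<approx> t\<close>; both sides must be nonempty.\<close>

definition identities :: "('a, 'b) monoid_scheme \<Rightarrow> ('a \<Rightarrow> 'a) \<Rightarrow> (trm \<times> trm) set" where
  "identities M star = {(s, t). s \<noteq> [] \<and> t \<noteq> [] \<and>
     (\<forall>\<theta>. range \<theta> \<subseteq> carrier M \<longrightarrow> eval_trm M star \<theta> s = eval_trm M star \<theta> t)}"

text \<open>\<open>replace_subterm u v s t\<close>: some occurrence of the subterm \<open>u\<close> in \<open>s\<close> is replaced by \<open>v\<close>,
  resulting in \<open>t\<close>.\<close>

inductive replace_subterm :: "trm \<Rightarrow> trm \<Rightarrow> trm \<Rightarrow> trm \<Rightarrow> bool" for u v where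
  whole: "replace_subterm u v u v"
| cat: "replace_subterm u v s t \<Longrightarrow> replace_subterm u v (l @ s @ r) (l @ t @ r)"
| star: "replace_subterm u v s t \<Longrightarrow> replace_subterm u v (star_trm s) (star_trm t)"

definition directly_deducible :: "trm \<times> trm \<Rightarrow> trm \<Rightarrow> trm \<Rightarrow> bool" where
  "directly_deducible = (\<lambda>(p, q) s t. \<exists>\<phi>. replace_subterm (subst_trm \<phi> p) (subst_trm \<phi> q) s t)"

definition deducible :: "(trm \<times> trm) set \<Rightarrow> trm \<Rightarrow> trm \<Rightarrow> bool" where
  "deducible \<Sigma> =
     (\<lambda>s t. \<exists>(p, q) \<in> \<Sigma>. directly_deducible (p, q) s t \<or> directly_deducible (q, p) s t)\<^sup>*\<^sup>*"

definition identity_basis :: "(trm \<times> trm) set \<Rightarrow> ('a, 'b) monoid_scheme \<Rightarrow> ('a \<Rightarrow> 'a) \<Rightarrow> bool" where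
  "identity_basis \<Sigma> M star \<longleftrightarrow>
     \<Sigma> \<subseteq> identities M star \<and> (\<forall>(s, t) \<in> identities M star. deducible \<Sigma> s t)"

definition finitely_based :: "('a, 'b) monoid_scheme \<Rightarrow> ('a \<Rightarrow> 'a) \<Rightarrow> bool" where
  "finitely_based M star \<longleftrightarrow> (\<exists>\<Sigma>. finite \<Sigma> \<and> identity_basis \<Sigma> M star)"


section \<open>The Baxter monoid and Schuetzenberger's involution\<close>

abbreviation letters :: "nat \<Rightarrow> nat set" where
  "letters n \<equiv> {1..n}"

inductive_set baxter_pairs :: "nat \<Rightarrow> (nat list \<times> nat list) set" for n where
  "\<lbrakk>a \<le> b; b < c; c \<le> d; {a, b, c, d} \<subseteq> letters n; u \<in> lists (letters n); v \<in> lists (letters n)\<rbrakk>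
   \<Longrightarrow> ([c] @ u @ [a, d] @ v @ [b], [c] @ u @ [d, a] @ v @ [b]) \<in> baxter_pairs n"
| "\<lbrakk>a < b; b \<le> c; c < d; {a, b, c, d} \<subseteq> letters n; u \<in> lists (letters n); v \<in> lists (letters n)\<rbrakk>
   \<Longrightarrow> ([b] @ u @ [d, a] @ v @ [c], [b] @ u @ [a, d] @ v @ [c]) \<in> baxter_pairs n"

inductive_set baxter_cong :: "nat \<Rightarrow> (nat list \<times> nat list) set" for n where
  gen: "(x, y) \<in> baxter_pairs n \<Longrightarrow> (x, y) \<in> baxter_cong n"
| refl: "x \<in> lists (letters n) \<Longrightarrow> (x, x) \<in> baxter_cong n"
| sym: "(x, y) \<in> baxter_cong n \<Longrightarrow> (y, x) \<in> baxter_cong n"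
| trans: "(x, y) \<in> baxter_cong n \<Longrightarrow> (y, z) \<in> baxter_cong n \<Longrightarrow> (x, z) \<in> baxter_cong n"
| cong: "(x, y) \<in> baxter_cong n \<Longrightarrow> l \<in> lists (letters n) \<Longrightarrow> r \<in> lists (letters n)
         \<Longrightarrow> (l @ x @ r, l @ y @ r) \<in> baxter_cong n"

definition baxt :: "nat \<Rightarrow> nat list set monoid" where
  "baxt n =
     \<lparr>carrier = lists (letters n) // baxter_cong n,
      mult = (\<lambda>X Y. \<Union>x\<in>X. \<Union>y\<in>Y. baxter_cong n `` {x @ y}),
      one = baxter_cong n `` {[]}\<rparr>"

definition sharp_word :: "nat \<Rightarrow> nat list \<Rightarrow> nat list" where
  "sharp_word n w = rev (map (\<lambda>i. n + 1 - i) w)"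

definition sharp :: "nat \<Rightarrow> nat list set \<Rightarrow> nat list set" where
  "sharp n X = (\<Union>x\<in>X. baxter_cong n `` {sharp_word n x})"

lemma baxter_cong_words:
  "(x, y) \<in> baxter_cong n \<Longrightarrow> x \<in> lists (letters n) \<and> y \<in> lists (letters n)"
  by (induction rule: baxter_cong.induct) (auto elim!: baxter_pairs.cases)

lemma equiv_baxter_cong: "equiv (lists (letters n)) (baxter_cong n)"
proof (rule equivI)
  show "baxter_cong n \<subseteq> lists (letters n) \<times> lists (letters n)"
    by (auto dest!: baxter_cong_words)
  show "refl_on (lists (letters n)) (baxter_cong n)"
    by (rule refl_onI) (rule baxter_cong.refl)
  show "sym (baxter_cong n)" by (rule symI) (rule baxter_cong.sym)
  show "trans (baxter_cong n)" by (rule transI) (rule baxter_cong.trans)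
qed

lemma baxter_cong_append:
  assumes "(x, x') \<in> baxter_cong n" "(y, y') \<in> baxter_cong n"
  shows "(x @ y, x' @ y') \<in> baxter_cong n"
proof -
  note w = baxter_cong_words[OF assms(1)] baxter_cong_words[OF assms(2)]
  have "(x @ y, x' @ y) \<in> baxter_cong n"
    using baxter_cong.cong[OF assms(1), of "[]" y] w by simp
  moreover have "(x' @ y, x' @ y') \<in> baxter_cong n"
    using baxter_cong.cong[OF assms(2), of x' "[]"] w by simp
  ultimately show ?thesis by (rule baxter_cong.trans)
qed

lemma append_respects: "(\<lambda>x y. baxter_cong n `` {x @ y}) respects2 baxter_cong n"
  by (rule congruent2I') (rule equiv_class_eq[OF equiv_baxter_cong baxter_cong_append])

lemma baxt_mult:
  assumes "x \<in> lists (letters n)" "y \<in> lists (letters n)"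
  shows "baxter_cong n `` {x} \<otimes>\<^bsub>baxt n\<^esub> baxter_cong n `` {y} = baxter_cong n `` {x @ y}"
  using UN_equiv_class2[OF equiv_baxter_cong equiv_baxter_cong append_respects assms]
  by (simp add: baxt_def)

lemma sharp_word_simps:
  "sharp_word n (x @ y) = sharp_word n y @ sharp_word n x"
  by (simp add: sharp_word_def)

lemma sharp_word_words: "x \<in> lists (letters n) \<Longrightarrow> sharp_word n x \<in> lists (letters n)"
  by (induction x) (auto simp: sharp_word_def)

lemma sharp_word_sharp_word: "x \<in> lists (letters n) \<Longrightarrow> sharp_word n (sharp_word n x) = x"
  by (induction x) (auto simp: sharp_word_def)

lemma sharp_word_pairs:
  assumes "(x, y) \<in> baxter_pairs n"
  shows "(sharp_word n x, sharp_word n y) \<in> baxter_pairs n"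
  using assms
proof cases
  case (1 a b c d u v)
  have "{n + 1 - d, n + 1 - c, n + 1 - b, n + 1 - a} \<subseteq> letters n"
    and "n + 1 - d \<le> n + 1 - c" "n + 1 - c < n + 1 - b" "n + 1 - b \<le> n + 1 - a"
    using 1 by auto
  from baxter_pairs.intros(1)[OF this(2-4) this(1) sharp_word_words[of v n] sharp_word_words[of u n]]
  show ?thesis
    using 1 by (simp add: sharp_word_def)
next
  case (2 a b c d u v)
  have "{n + 1 - d, n + 1 - c, n + 1 - b, n + 1 - a} \<subseteq> letters n"
    and "n + 1 - d < n + 1 - c" "n + 1 - c \<le> n + 1 - b" "n + 1 - b < n + 1 - a"
    using 2 by auto
  from baxter_pairs.intros(2)[OF this(2-4) this(1) sharp_word_words[of v n] sharp_word_words[of u n]]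
  show ?thesis
    using 2 by (simp add: sharp_word_def)
qed

lemma sharp_word_cong:
  "(x, y) \<in> baxter_cong n \<Longrightarrow> (sharp_word n x, sharp_word n y) \<in> baxter_cong n"
proof (induction rule: baxter_cong.induct)
  case (gen x y)
  then show ?case by (intro baxter_cong.gen sharp_word_pairs)
next
  case (refl x)
  then show ?case by (intro baxter_cong.refl sharp_word_words)
next
  case (sym x y)
  show ?case using sym.IH by (rule baxter_cong.sym)
next
  case (trans x y z)
  show ?case using trans.IH by (rule baxter_cong.trans)
next
  case (cong x y l r)
  then show ?case
    using baxter_cong.cong[OF cong.IH sharp_word_words[OF cong.hyps(3)]
        sharp_word_words[OF cong.hyps(2)]]
    by (simp add: sharp_word_simps)
qed

lemma sharp_respects: "(\<lambda>x. baxter_cong n `` {sharp_word n x}) respects baxter_cong n"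
  by (rule congruentI) (rule equiv_class_eq[OF equiv_baxter_cong sharp_word_cong])

lemma sharp_class:
  "x \<in> lists (letters n) \<Longrightarrow> sharp n (baxter_cong n `` {x}) = baxter_cong n `` {sharp_word n x}"
  using UN_equiv_class[OF equiv_baxter_cong sharp_respects] by (simp add: sharp_def)

lemma baxt_carrierE:
  assumes "X \<in> carrier (baxt n)"
  obtains x where "x \<in> lists (letters n)" "X = baxter_cong n `` {x}"
  using assms by (auto simp: baxt_def elim!: quotientE)

lemma baxt_carrierI: "x \<in> lists (letters n) \<Longrightarrow> baxter_cong n `` {x} \<in> carrier (baxt n)"
  by (simp add: baxt_def quotientI)

lemma baxt_one: "\<one>\<^bsub>baxt n\<^esub> = baxter_cong n `` {[]}"
  by (simp add: baxt_def)

lemma involution_monoid_baxt: "involution_monoid (baxt n) (sharp n)"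
proof unfold_locales
  show "\<one>\<^bsub>baxt n\<^esub> \<in> carrier (baxt n)"
    by (simp add: baxt_one baxt_carrierI)
next
  fix X assume "X \<in> carrier (baxt n)"
  then obtain x where x: "x \<in> lists (letters n)" "X = baxter_cong n `` {x}"
    by (rule baxt_carrierE)
  show "\<one>\<^bsub>baxt n\<^esub> \<otimes>\<^bsub>baxt n\<^esub> X = X" "X \<otimes>\<^bsub>baxt n\<^esub> \<one>\<^bsub>baxt n\<^esub> = X"
    unfolding baxt_one x(2) using baxt_mult[of "[]" n x] baxt_mult[of x n "[]"] x(1) by simp_all
  note sx = sharp_word_words[OF x(1)]
  show "sharp n X \<in> carrier (baxt n)"
    unfolding x(2) sharp_class[OF x(1)] by (rule baxt_carrierI[OF sx])
  show "sharp n (sharp n X) = X"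
    unfolding x(2) sharp_class[OF x(1)] sharp_class[OF sx] sharp_word_sharp_word[OF x(1)] ..
  fix Y assume "Y \<in> carrier (baxt n)"
  then obtain y where y: "y \<in> lists (letters n)" "Y = baxter_cong n `` {y}"
    by (rule baxt_carrierE)
  note sy = sharp_word_words[OF y(1)]
  have xy: "x @ y \<in> lists (letters n)" using x(1) y(1) by simp
  show "X \<otimes>\<^bsub>baxt n\<^esub> Y \<in> carrier (baxt n)"
    unfolding x(2) y(2) baxt_mult[OF x(1) y(1)] by (rule baxt_carrierI[OF xy])
  show "sharp n (X \<otimes>\<^bsub>baxt n\<^esub> Y) = sharp n Y \<otimes>\<^bsub>baxt n\<^esub> sharp n X"
    unfolding x(2) y(2) baxt_mult[OF x(1) y(1)] sharp_class[OF x(1)] sharp_class[OF y(1)]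
      sharp_class[OF xy] baxt_mult[OF sy sx] sharp_word_simps ..
  fix Z assume "Z \<in> carrier (baxt n)"
  then obtain z where z: "z \<in> lists (letters n)" "Z = baxter_cong n `` {z}"
    by (rule baxt_carrierE)
  have yz: "y @ z \<in> lists (letters n)" using y(1) z(1) by simp
  show "X \<otimes>\<^bsub>baxt n\<^esub> Y \<otimes>\<^bsub>baxt n\<^esub> Z = X \<otimes>\<^bsub>baxt n\<^esub> (Y \<otimes>\<^bsub>baxt n\<^esub> Z)"
    unfolding x(2) y(2) z(2) baxt_mult[OF x(1) y(1)] baxt_mult[OF y(1) z(1)]
      baxt_mult[OF xy z(1)] baxt_mult[OF x(1) yz] by simp
qed

end

theory Submission
  imports Defs "HOL-Library.Multiset"
begin

text \<open>
  Up to the involution laws a term is a word over literals \<open>x\<close>, \<open>x\<^sup>*\<close>. Consider, for each \<open>n\<close>,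
  the identity \<open>A z y\<^sub>1 \<dots> y\<^sub>n z\<^sup>* A \<approx> A z\<^sup>* y\<^sub>1 \<dots> y\<^sub>n z A\<close> with
  \<open>A = z z\<^sup>* y\<^sub>1\<^sup>* \<dots> y\<^sub>n\<^sup>*\<close>. It holds in rank 3: if the value of \<open>z\<close> is a power of 2, then it
  equals that of \<open>z\<^sup>*\<close>; otherwise the values of both copies of \<open>A\<close> contain 1 and 3, and also 2
  if the middle does, so that all letters of the middle commute.

  Conversely, the content of a word over \<open>{1,2,3}\<close>, the number of 1s before the first 2 and the
  number of 2s before the first 3 are invariants. The first two show that the letters in front of
  the first occurrence of a variable \<open>h\<close> are determined up to order, the last one that any word
  identified with a side of the critical identity begins like one of its two sides, up to
  \<open>y\<^sub>n\<close>. If an identity of length less than \<open>n\<close> is applied to such a word across \<open>y\<^sub>1 \<dots> y\<^sub>n\<close>,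
  then some literal \<open>h\<close> of it is mapped to a word containing \<open>y\<^sub>i y\<^sub>i\<^sub>+\<^sub>1\<close>. As
  \<open>y\<^sub>i\<^sub>+\<^sub>1\<^sup>* y\<^sub>i\<^sup>*\<close> does not occur before, this is the first occurrence of the variable of \<open>h\<close>;
  so the number of \<open>z\<close> in front of \<open>y\<^sub>i\<close>, which distinguishes the two sides, cannot change.
\<close>

section \<open>Words over starred and unstarred variables\<close>

text \<open>The flag marks a starred variable; by the involution laws every term reduces to a word
  in such literals.\<close>

type_synonym literal = "nat \<times> bool"

definition word_star :: "literal list \<Rightarrow> literal list" where
  "word_star w = rev (map (\<lambda>(x, b). (x, \<not> b)) w)"

lemma word_star_append [simp]: "word_star (u @ v) = word_star v @ word_star u"
  by (simp add: word_star_def)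

lemma word_star_Nil [simp]: "word_star [] = []"
  by (simp add: word_star_def)

lemma word_star_Cons [simp]: "word_star (x # v) = word_star v @ [(fst x, \<not> snd x)]"
  by (simp add: word_star_def case_prod_beta)

lemma word_star_word_star [simp]: "word_star (word_star w) = w"
  by (induction w) auto

lemma length_word_star [simp]: "length (word_star w) = length w"
  by (simp add: word_star_def)

primrec factor_word :: "factor \<Rightarrow> literal list" where
  "factor_word (Var x) = [(x, False)]"
| "factor_word (Star f fs) = word_star (factor_word f @ concat (map factor_word fs))"

definition trm_word :: "trm \<Rightarrow> literal list" where
  "trm_word t = concat (map factor_word t)"

lemma trm_word_simps [simp]:
  "trm_word [] = []"
  "trm_word [Var x] = [(x, False)]"
  "trm_word (s @ t) = trm_word s @ trm_word t"
  "trm_word (star_trm t) = word_star (trm_word t)"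
  by (simp_all add: trm_word_def) (cases t; simp)

definition word_trm :: "literal list \<Rightarrow> trm" where
  "word_trm w = map (\<lambda>(x, b). if b then Star (Var x) [] else Var x) w"

lemma trm_word_word_trm [simp]: "trm_word (word_trm w) = w"
  by (induction w) (auto simp: trm_word_def word_trm_def)

text \<open>The homomorphic extension of \<open>\<theta>\<close> in which a star acts as
  \<open>\<iota>\<close>: substitution for \<open>\<iota> = word_star\<close>, evaluation for
  \<open>\<iota> = sharp_word n\<close>.\<close>

definition lift :: "('a list \<Rightarrow> 'a list) \<Rightarrow> (nat \<Rightarrow> 'a list) \<Rightarrow> literal list \<Rightarrow> 'a list" where
  "lift \<iota> \<theta> w = concat (map (\<lambda>x. if snd x then \<iota> (\<theta> (fst x)) else \<theta> (fst x)) w)"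

lemma lift_simps [simp]:
  "lift \<iota> \<theta> [] = []"
  "lift \<iota> \<theta> (l # w) = (if snd l then \<iota> (\<theta> (fst l)) else \<theta> (fst l)) @ lift \<iota> \<theta> w"
  "lift \<iota> \<theta> (u @ v) = lift \<iota> \<theta> u @ lift \<iota> \<theta> v"
  by (simp_all add: lift_def)

lemma lift_word_star:
  assumes "\<And>u v. \<iota> (u @ v) = \<iota> v @ \<iota> u" "\<And>x. \<iota> (\<iota> (\<theta> x)) = \<theta> x"
  shows "lift \<iota> \<theta> (word_star w) = \<iota> (lift \<iota> \<theta> w)"
proof (induction w)
  case Nil
  have "\<iota> [] = []" using assms(1)[of "[]" "[]"] by simp
  then show ?case by simp
qed (simp add: assms)

lemma lift_lift:
  assumes "\<And>u v. \<iota> (u @ v) = \<iota> v @ \<iota> u" "\<And>x. \<iota> (\<iota> (\<theta> x)) = \<theta> x"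
  shows "lift \<iota> \<theta> (lift word_star \<psi> w) = lift \<iota> (\<lambda>x. lift \<iota> \<theta> (\<psi> x)) w"
  by (induction w) (simp_all add: lift_word_star[of \<iota> \<theta>, OF assms])

lemma mset_lift_cong:
  assumes "mset u = mset v"
  shows "mset (lift \<iota> \<theta> u) = mset (lift \<iota> \<theta> v)"
proof -
  have "mset (lift \<iota> \<theta> w) =
      (\<Sum>l\<in>#mset w. mset (if snd l then \<iota> (\<theta> (fst l)) else \<theta> (fst l)))" for w
    by (induction w) simp_all
  then show ?thesis using assms by simp
qed

lemma trm_word_subst:
  "trm_word (subst_trm \<phi> t) = lift word_star (\<lambda>x. trm_word (\<phi> x)) (trm_word t)"
  by (induction t rule: trm_induct) (simp_all add: subst_trm_simps lift_word_star)

text \<open>Only the parity of the number of stars around the replaced subterm matters: each star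
  reverses the context and toggles \<open>f\<close> between \<open>id\<close> and
  \<open>word_star\<close>.\<close>

lemma replace_subterm_word:
  assumes "replace_subterm u v s t"
  shows "\<exists>l r f. (f = id \<or> f = word_star) \<and>
    trm_word s = l @ f (trm_word u) @ r \<and> trm_word t = l @ f (trm_word v) @ r"
  using assms
proof induction
  case whole
  show ?case by (rule exI[of _ "[]"], rule exI[of _ "[]"], rule exI[of _ id]) simp
next
  case (cat s t l r)
  then obtain l' r' f where "f = id \<or> f = word_star"
    "trm_word s = l' @ f (trm_word u) @ r'" "trm_word t = l' @ f (trm_word v) @ r'"
    by blast
  then show ?case
    by (rule_tac x = "trm_word l @ l'" in exI, rule_tac x = "r' @ trm_word r" in exI,
        rule_tac x = f in exI) (simp add: id_def)
next
  case (star s t)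
  then obtain l r f where f: "f = id \<or> f = word_star"
    "trm_word s = l @ f (trm_word u) @ r" "trm_word t = l @ f (trm_word v) @ r"
    by blast
  define g where "g = (if f = id then word_star else id)"
  have "word_star (f x) = g x" for x
    using f(1) by (auto simp: g_def)
  then have "trm_word (star_trm s) = word_star r @ g (trm_word u) @ word_star l"
    "trm_word (star_trm t) = word_star r @ g (trm_word v) @ word_star l"
    using f by simp_all
  moreover have "g = id \<or> g = word_star" by (simp add: g_def)
  ultimately show ?case by blast
qed


section \<open>Identities of the Baxter monoid of rank 3 as word identities\<close>

text \<open>Stated on representatives of classes, so that the later arguments deal with words
  instead of quotients.\<close>

definition word_identity :: "literal list \<Rightarrow> literal list \<Rightarrow> bool" where
  "word_identity p q \<longleftrightarrow> (\<forall>\<theta>. range \<theta> \<subseteq> lists (letters 3) \<longrightarrow>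
     (lift (sharp_word 3) \<theta> p, lift (sharp_word 3) \<theta> q) \<in> baxter_cong 3)"

lemma sharp_word_inverse:
  "range \<theta> \<subseteq> lists (letters n) \<Longrightarrow> sharp_word n (sharp_word n (\<theta> x)) = \<theta> x"
  by (rule sharp_word_sharp_word) auto

lemma lift_sharp_word_words:
  assumes "range \<theta> \<subseteq> lists (letters n)"
  shows "lift (sharp_word n) \<theta> w \<in> lists (letters n)"
proof (induction w)
  case (Cons l w)
  have "\<theta> (fst l) \<in> lists (letters n)" using assms by auto
  then have "sharp_word n (\<theta> (fst l)) \<in> lists (letters n)" "\<theta> (fst l) \<in> lists (letters n)"
    using sharp_word_words by auto
  with Cons show ?case by auto
qed simp

lemma eval_trm_baxt:
  assumes "range \<theta> \<subseteq> lists (letters n)"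
  shows "eval_trm (baxt n) (sharp n) (\<lambda>x. baxter_cong n `` {\<theta> x}) t =
    baxter_cong n `` {lift (sharp_word n) \<theta> (trm_word t)}"
proof -
  interpret involution_monoid "baxt n" "sharp n" by (rule involution_monoid_baxt)
  have r: "range (\<lambda>x. baxter_cong n `` {\<theta> x}) \<subseteq> carrier (baxt n)"
    using assms baxt_carrierI by blast
  show ?thesis
  proof (induction t rule: trm_induct)
    case 1
    show ?case using eval_trm_simps(1)[OF r] by (simp add: baxt_one)
  next
    case (2 x)
    show ?case using eval_trm_simps(2)[OF r] by simp
  next
    case (3 s t)
    then show ?case
      by (simp add: eval_trm_simps(3)[OF r]
          baxt_mult[OF lift_sharp_word_words[OF assms] lift_sharp_word_words[OF assms]])
  next
    case (4 t)
    then show ?case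
      by (simp add: eval_trm_simps(4)[OF r] sharp_class[OF lift_sharp_word_words[OF assms]]
          lift_word_star sharp_word_simps sharp_word_inverse[OF assms])
  qed
qed

lemma identities_baxt_iff:
  "(s, t) \<in> identities (baxt 3) (sharp 3) \<longleftrightarrow>
    s \<noteq> [] \<and> t \<noteq> [] \<and> word_identity (trm_word s) (trm_word t)"
proof -
  have "(\<forall>\<Theta> :: nat \<Rightarrow> _. range \<Theta> \<subseteq> carrier (baxt 3) \<longrightarrow>
      eval_trm (baxt 3) (sharp 3) \<Theta> s = eval_trm (baxt 3) (sharp 3) \<Theta> t) \<longleftrightarrow>
    word_identity (trm_word s) (trm_word t)" (is "?L \<longleftrightarrow> ?R")
  proof
    assume L: ?L
    show ?R unfolding word_identity_def
    proof (intro allI impI)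
      fix \<theta> :: "nat \<Rightarrow> nat list"
      assume \<theta>: "range \<theta> \<subseteq> lists (letters 3)"
      then have "range (\<lambda>x. baxter_cong 3 `` {\<theta> x}) \<subseteq> carrier (baxt 3)"
        using baxt_carrierI by blast
      from L[rule_format, OF this]
      show "(lift (sharp_word 3) \<theta> (trm_word s), lift (sharp_word 3) \<theta> (trm_word t))
          \<in> baxter_cong 3"
        unfolding eval_trm_baxt[OF \<theta>]
        using eq_equiv_class[OF _ equiv_baxter_cong] lift_sharp_word_words[OF \<theta>] by blast
    qed
  next
    assume R: ?R
    show ?L
    proof (intro allI impI)
      fix \<Theta> :: "nat \<Rightarrow> nat list set" assume "range \<Theta> \<subseteq> carrier (baxt 3)"
      then have "\<forall>x. \<exists>w. w \<in> lists (letters 3) \<and> \<Theta> x = baxter_cong 3 `` {w}"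
        by (meson baxt_carrierE range_subsetD)
      then obtain \<theta> where \<theta>: "\<And>x. \<theta> x \<in> lists (letters 3)" "\<And>x. \<Theta> x = baxter_cong 3 `` {\<theta> x}"
        by metis
      have eq: "\<Theta> = (\<lambda>x. baxter_cong 3 `` {\<theta> x})" using \<theta>(2) by blast
      have r: "range \<theta> \<subseteq> lists (letters 3)" using \<theta>(1) by blast
      show "eval_trm (baxt 3) (sharp 3) \<Theta> s = eval_trm (baxt 3) (sharp 3) \<Theta> t"
        unfolding eq eval_trm_baxt[OF r]
        using R r unfolding word_identity_def
        by (intro equiv_class_eq[OF equiv_baxter_cong]) blast
    qed
  qed
  then show ?thesis by (simp add: identities_def)
qed

lemma word_identity_trans:
  "word_identity p q \<Longrightarrow> word_identity q r \<Longrightarrow> word_identity p r"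
  unfolding word_identity_def using baxter_cong.trans by blast

lemma word_identity_sym: "word_identity p q \<Longrightarrow> word_identity q p"
  unfolding word_identity_def using baxter_cong.sym by blast

lemma word_identity_word_star:
  assumes "word_identity p q"
  shows "word_identity (word_star p) (word_star q)"
  using assms sharp_word_cong
  by (simp add: word_identity_def lift_word_star sharp_word_simps sharp_word_inverse)

lemma word_identity_lift:
  assumes "word_identity p q"
  shows "word_identity (l @ lift word_star \<psi> p @ r) (l @ lift word_star \<psi> q @ r)"
  unfolding word_identity_def
proof (intro allI impI)
  fix \<theta> :: "nat \<Rightarrow> nat list"
  assume \<theta>: "range \<theta> \<subseteq> lists (letters 3)"
  let ?\<theta> = "\<lambda>x. lift (sharp_word 3) \<theta> (\<psi> x)"
  have "range ?\<theta> \<subseteq> lists (letters 3)" using lift_sharp_word_words[OF \<theta>] by blast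
  then have "(lift (sharp_word 3) ?\<theta> p, lift (sharp_word 3) ?\<theta> q) \<in> baxter_cong 3"
    using assms unfolding word_identity_def by blast
  then show "(lift (sharp_word 3) \<theta> (l @ lift word_star \<psi> p @ r),
      lift (sharp_word 3) \<theta> (l @ lift word_star \<psi> q @ r)) \<in> baxter_cong 3"
    using lift_sharp_word_words[OF \<theta>]
    by (simp add: lift_lift sharp_word_simps sharp_word_inverse[OF \<theta>] baxter_cong.cong
        del: in_lists_conv_set)
qed

text \<open>A star around the replaced instance is absorbed by starring both sides of the identity.
  This preserves the length, on which the final pigeonhole argument relies.\<close>

lemma directly_deducible_word:
  assumes "directly_deducible (p, q) s t" "word_identity (trm_word p) (trm_word q)"
  obtains l r p' q' \<psi> where "word_identity p' q'" "length p' = length (trm_word p)"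
    "trm_word s = l @ lift word_star \<psi> p' @ r" "trm_word t = l @ lift word_star \<psi> q' @ r"
proof -
  obtain \<phi> where "replace_subterm (subst_trm \<phi> p) (subst_trm \<phi> q) s t"
    using assms(1) by (auto simp: directly_deducible_def)
  from replace_subterm_word[OF this] obtain l r f where f: "f = id \<or> f = word_star"
    "trm_word s = l @ f (trm_word (subst_trm \<phi> p)) @ r"
    "trm_word t = l @ f (trm_word (subst_trm \<phi> q)) @ r" by blast
  let ?\<psi> = "\<lambda>x. trm_word (\<phi> x)"
  have "f (trm_word (subst_trm \<phi> x)) = lift word_star ?\<psi> (f (trm_word x))" for x
    using f(1) by (auto simp: trm_word_subst lift_word_star)
  then show thesis
    using f assms(2) word_identity_word_star that[of "f (trm_word p)" "f (trm_word q)" l ?\<psi> r]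
    by auto
qed


section \<open>Invariants of the Baxter congruence\<close>

text \<open>If \<open>b\<close> does not occur, all occurrences of \<open>a\<close> count.\<close>

definition count_before :: "'a \<Rightarrow> 'a \<Rightarrow> 'a list \<Rightarrow> nat" where
  "count_before a b w = count (mset (takeWhile (\<lambda>x. x \<noteq> b) w)) a"

lemma count_before_simps [simp]:
  "count_before a b [] = 0"
  "count_before a b (x # w) =
    (if x = b then 0 else if x = a then Suc (count_before a b w) else count_before a b w)"
  by (simp_all add: count_before_def)

lemma count_before_append [simp]:
  "count_before a b (u @ v) =
    (if b \<in> set u then count_before a b u else count (mset u) a + count_before a b v)"
  by (induction u) auto

lemma baxter_cong_mset: "(x, y) \<in> baxter_cong n \<Longrightarrow> mset x = mset y"
proof (induction rule: baxter_cong.induct)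
  case (gen x y)
  then show ?case by cases simp_all
qed simp_all

text \<open>A generating pair exchanges two adjacent letters. If their values are consecutive, the
  pair is of the first kind and its first letter equals the larger of the two, so the delimiter
  already lies further left. Otherwise at most one of them is counted or delimits, and their order
  is irrelevant.\<close>

lemma baxter_cong_count_before:
  "(x, y) \<in> baxter_cong n \<Longrightarrow> count_before a (Suc a) x = count_before a (Suc a) y"
proof (induction rule: baxter_cong.induct)
  case (gen x y)
  then show ?case by cases simp_all
next
  case (cong x y l r)
  have "mset x = mset y" using cong.hyps(1) by (rule baxter_cong_mset)
  then show ?case using cong.IH mset_eq_setD[of x y] by simp
qed simp_all

lemma word_identity_count:
  assumes "word_identity p q"
  shows "count (mset p) l = count (mset q) l"
proof -
  \<comment> \<open>Chosen so that \<open>l\<close> itself evaluates to 1 and the opposite literal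
    to 3, for the involution exchanges 1 and 3.\<close>
  define \<theta> where "\<theta> = (\<lambda>x. if x = fst l then if snd l then [3] else [1] else [] :: nat list)"
  have *: "count (mset (lift (sharp_word 3) \<theta> w)) 1 = count (mset w) l" for w
    by (induction w) (auto simp: \<theta>_def sharp_word_def prod_eq_iff)
  have "range \<theta> \<subseteq> lists (letters 3)" by (auto simp: \<theta>_def)
  then have "mset (lift (sharp_word 3) \<theta> p) = mset (lift (sharp_word 3) \<theta> q)"
    using assms baxter_cong_mset unfolding word_identity_def by blast
  then show ?thesis using *[of p] *[of q] by simp
qed

lemma word_identity_mset: "word_identity p q \<Longrightarrow> mset p = mset q"
  by (simp add: multiset_eq_iff word_identity_count)

lemma word_identity_count_before:
  assumes "word_identity p q" "range \<theta> \<subseteq> lists (letters 3)"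
  shows "count_before a (Suc a) (lift (sharp_word 3) \<theta> p) =
    count_before a (Suc a) (lift (sharp_word 3) \<theta> q)"
  using assms baxter_cong_count_before unfolding word_identity_def by blast

lemma word_identity_count_before_variable:
  assumes "word_identity p q" "fst l \<noteq> y"
  shows "count (mset (takeWhile (\<lambda>m. fst m \<noteq> y) p)) l =
    count (mset (takeWhile (\<lambda>m. fst m \<noteq> y) q)) l"
proof -
  \<comment> \<open>As 2 is fixed by the involution, both literals of \<open>y\<close> become the
    delimiter 2, while \<open>l\<close> becomes 1.\<close>
  define \<theta> where "\<theta> = (\<lambda>x. if x = fst l then if snd l then [3] else [1]
    else if x = y then [2] else [] :: nat list)"
  have *: "count_before 1 (Suc 1) (lift (sharp_word 3) \<theta> w) =
      count (mset (takeWhile (\<lambda>m. fst m \<noteq> y) w)) l" for w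
    using assms(2) by (induction w) (auto simp: \<theta>_def sharp_word_def prod_eq_iff)
  have "range \<theta> \<subseteq> lists (letters 3)" by (auto simp: \<theta>_def)
  from word_identity_count_before[OF assms(1) this, of 1] show ?thesis unfolding * .
qed

lemma word_identity_first_literal:
  assumes "word_identity (p1 @ h # p2) q" "fst h \<notin> fst ` set p1"
  obtains q1 q2 where "q = q1 @ h # q2" "fst h \<notin> fst ` set q1" "mset p1 = mset q1"
proof -
  \<comment> \<open>Here \<open>h\<close> evaluates to \<open>[1, 2]\<close> and the opposite
    literal to \<open>[2, 3]\<close>, so the number of 1s before the first 2 tells which of them
    occurs first.\<close>
  define \<theta> where "\<theta> = (\<lambda>x. if x = fst h then if snd h then [2, 3] else [1, 2] else [] :: nat list)"
  have "\<exists>m\<in>set q. fst m = fst h"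
    using mset_eq_setD[OF word_identity_mset[OF assms(1)]] by auto
  from split_list_first_prop[OF this] obtain q1 h' q2
    where q: "q = q1 @ h' # q2" "fst h' = fst h" "\<forall>m\<in>set q1. fst m \<noteq> fst h"
    by blast
  then have q1: "fst h \<notin> fst ` set q1" by force
  have empty: "lift (sharp_word 3) \<theta> w = []" if "fst h \<notin> fst ` set w" for w
    using that by (induction w) (auto simp: \<theta>_def sharp_word_def)
  have "range \<theta> \<subseteq> lists (letters 3)" by (auto simp: \<theta>_def)
  from word_identity_count_before[OF assms(1) this, of 1]
  have "snd h' = snd h"
    unfolding q(1) lift_simps empty[OF assms(2)] empty[OF q1]
    by (auto simp: q(2) \<theta>_def sharp_word_def split: if_splits)
  then have h: "h' = h" using q(2) by (simp add: prod_eq_iff)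
  have "takeWhile (\<lambda>m. fst m \<noteq> fst h) (p1 @ h # p2) = p1"
    using assms(2) by (subst takeWhile_append2) (auto intro: rev_image_eqI)
  moreover have "takeWhile (\<lambda>m. fst m \<noteq> fst h) q = q1"
    unfolding q(1) using q(2,3) by (subst takeWhile_append2) auto
  ultimately have "count (mset p1) l = count (mset q1) l" if "fst l \<noteq> fst h" for l
    using word_identity_count_before_variable[OF assms(1) that] by simp
  moreover have "count (mset p1) l = count (mset q1) l" if "fst l = fst h" for l
  proof -
    have "l \<notin> set p1" "l \<notin> set q1" using that assms(2) q1 by (metis imageI)+
    then have "count (mset p1) l = 0" "count (mset q1) l = 0"
      by (metis not_in_iff set_mset_mset)+
    then show ?thesis by metis
  qed
  ultimately have "mset p1 = mset q1" unfolding multiset_eq_iff by blast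
  then show thesis using that[of q1 q2] q(1) q1 h by simp
qed

lemma word_identity_count_before_literal:
  assumes "word_identity p q"
  shows "count (mset (map fst (takeWhile (\<lambda>m. m \<noteq> y) p))) z =
    count (mset (map fst (takeWhile (\<lambda>m. m \<noteq> y) q))) z"
proof -
  \<comment> \<open>Only the literal \<open>y\<close> evaluates to a word with a 3, and every
    occurrence of the variable \<open>z\<close>, starred or not, contributes exactly one 2.\<close>
  define \<theta> where "\<theta> = (\<lambda>x. if x = fst y then
      if x = z then if snd y then [1, 2] else [2, 3] else if snd y then [1] else [3]
    else if x = z then [2] else [] :: nat list)"
  \<comment> \<open>The correction is the 2 preceding the 3 in the value of \<open>y\<close> when
    \<open>y\<close> is a literal of \<open>z\<close>.\<close>
  have *: "count_before 2 (Suc 2) (lift (sharp_word 3) \<theta> w) =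
      count (mset (map fst (takeWhile (\<lambda>m. m \<noteq> y) w))) z + (if y \<in> set w \<and> fst y = z then 1 else 0)" for w
    by (induction w) (auto simp: \<theta>_def sharp_word_def prod_eq_iff)
  have "range \<theta> \<subseteq> lists (letters 3)" by (auto simp: \<theta>_def)
  from word_identity_count_before[OF assms(1) this, of 2] show ?thesis
    unfolding * using mset_eq_setD[OF word_identity_mset[OF assms]] by simp
qed


section \<open>Commutation in the middle of a word\<close>

text \<open>The order of the witnesses decides which kind of generating pair applies: the first for
  \<open>y < x\<close>, the second for \<open>x \<le> y\<close>.\<close>

lemma baxter_cong_swap:
  assumes "x \<in> set p" "y \<in> set r" "a < x" "x \<le> d" "a \<le> y" "y < d"
    and "p \<in> lists (letters n)" "r \<in> lists (letters n)" "a \<in> letters n" "d \<in> letters n"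
  shows "(p @ [a, d] @ r, p @ [d, a] @ r) \<in> baxter_cong n"
proof -
  obtain p1 p2 where p: "p = p1 @ x # p2" using split_list[OF assms(1)] by blast
  obtain r1 r2 where r: "r = r1 @ y # r2" using split_list[OF assms(2)] by blast
  have w: "{a, y, x, d} \<subseteq> letters n" "{a, x, y, d} \<subseteq> letters n"
    "p1 \<in> lists (letters n)" "p2 \<in> lists (letters n)"
    "r1 \<in> lists (letters n)" "r2 \<in> lists (letters n)"
    using assms(7-) p r by auto
  have "([x] @ p2 @ [a, d] @ r1 @ [y], [x] @ p2 @ [d, a] @ r1 @ [y]) \<in> baxter_cong n"
  proof (cases "y < x")
    case True
    then show ?thesis
      using baxter_pairs.intros(1)[OF \<open>a \<le> y\<close> True \<open>x \<le> d\<close> w(1) w(4) w(5)] baxter_cong.gen by blast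
  next
    case False
    then show ?thesis
      using baxter_pairs.intros(2)[OF \<open>a < x\<close> _ \<open>y < d\<close> w(2) w(4) w(5)] baxter_cong.gen
        baxter_cong.sym by (meson leI)
  qed
  from baxter_cong.cong[OF this w(3) w(6)] show ?thesis by (simp add: p r)
qed

lemma baxter_cong_middle_swap:
  assumes "{1, 3} \<subseteq> set p" "{1, 3} \<subseteq> set r" "p \<in> lists (letters 3)" "r \<in> lists (letters 3)"
    and "a \<in> letters 3" "b \<in> letters 3"
    and "2 \<in> {a, b} \<Longrightarrow> 2 \<in> set p \<and> 2 \<in> set r"
  shows "(p @ [a, b] @ r, p @ [b, a] @ r) \<in> baxter_cong 3"
proof -
  have less: "(p @ [c, d] @ r, p @ [d, c] @ r) \<in> baxter_cong 3"
    if "c < d" "{c, d} = {a, b}" for c d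
  proof -
    have cd: "c \<in> letters 3" "d \<in> letters 3" "2 \<in> {c, d} \<Longrightarrow> 2 \<in> set p \<and> 2 \<in> set r"
      using that(2) assms(5-7) by (auto simp: doubleton_eq_iff)
    have "c = 1 \<or> c = 2" "d = 2 \<or> d = 3"
      using cd(1,2) that(1) unfolding atLeastAtMost_iff by linarith+
    \<comment> \<open>The larger letter is its own witness on the left, the smaller one on the
      right.\<close>
    then have "d \<in> set p" "c \<in> set r"
      using cd(3) assms(1,2) by auto
    then show ?thesis
      using baxter_cong_swap[of d p c r c d 3] cd(1,2) that(1) assms(3,4) by blast
  qed
  consider "a < b" | "b < a" | "a = b" by linarith
  then show ?thesis
  proof cases
    case 1
    then show ?thesis using less[of a b] by simp
  next
    case 2
    then show ?thesis using less[of b a] baxter_cong.sym by (simp add: insert_commute)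
  next
    case 3
    have "p @ [a, b] @ r \<in> lists (letters 3)" using assms(3-6) by simp
    then show ?thesis using 3 baxter_cong.refl by simp
  qed
qed

lemma baxter_cong_middle_move:
  assumes "{1, 3} \<subseteq> set p" "{1, 3} \<subseteq> set r" "p \<in> lists (letters 3)" "r \<in> lists (letters 3)"
    and "a # m \<in> lists (letters 3)"
    and "2 \<in> set (a # m) \<longrightarrow> 2 \<in> set p \<and> 2 \<in> set r"
  shows "(p @ m @ a # r, p @ a # m @ r) \<in> baxter_cong 3"
  using assms
proof (induction m arbitrary: p)
  case Nil
  have "p @ a # r \<in> lists (letters 3)" using Nil.prems by simp
  then show ?case using baxter_cong.refl by simp
next
  case (Cons b m)
  have "((p @ [b]) @ m @ a # r, (p @ [b]) @ a # m @ r) \<in> baxter_cong 3"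
    using Cons.prems by (intro Cons.IH) auto
  moreover have "(p @ [b, a] @ m @ r, p @ [a, b] @ m @ r) \<in> baxter_cong 3"
    using Cons.prems by (intro baxter_cong_middle_swap) auto
  ultimately show ?case
    using baxter_cong.trans[of "p @ b # m @ a # r" "p @ [b, a] @ m @ r" 3] by simp
qed

text \<open>The head of \<open>m\<close> is brought to the front of \<open>m'\<close> and then joins
  the prefix, whose content only grows.\<close>

lemma baxter_cong_middle:
  assumes "mset m = mset m'"
    and "{1, 3} \<subseteq> set p" "{1, 3} \<subseteq> set r" "p \<in> lists (letters 3)" "r \<in> lists (letters 3)"
    and "m \<in> lists (letters 3)"
    and "2 \<in> set m \<longrightarrow> 2 \<in> set p \<and> 2 \<in> set r"
  shows "(p @ m @ r, p @ m' @ r) \<in> baxter_cong 3"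
  using assms
proof (induction m arbitrary: m' p)
  case Nil
  have "p @ r \<in> lists (letters 3)" using Nil.prems by simp
  then show ?case using Nil.prems(1) baxter_cong.refl by simp
next
  case (Cons a m)
  have "a \<in> set m'" using mset_eq_setD[OF Cons.prems(1)] by auto
  then obtain u v where m': "m' = u @ a # v" by (meson split_list)
  have m: "mset m = mset (u @ v)" using Cons.prems(1) by (simp add: m')
  have s: "set m = set u \<union> set v" using mset_eq_setD[OF m] by simp
  have "((p @ [a]) @ m @ r, (p @ [a]) @ (u @ v) @ r) \<in> baxter_cong 3"
    using Cons.prems by (intro Cons.IH m) auto
  moreover have "(p @ u @ a # (v @ r), p @ a # u @ (v @ r)) \<in> baxter_cong 3"
    using Cons.prems s by (intro baxter_cong_middle_move) auto
  ultimately show ?case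
    using baxter_cong.trans[OF _ baxter_cong.sym, of "p @ a # m @ r" "p @ a # u @ v @ r" 3]
    by (simp add: m')
qed


section \<open>The critical identities\<close>

text \<open>Variable 0 plays the role of \<open>z\<close>, and variable \<open>i \<ge> 1\<close> that of \<open>y\<^sub>i\<close>.\<close>

definition frame :: "nat \<Rightarrow> literal list" where
  "frame n = [(0, False), (0, True)] @ map (\<lambda>i. (i, True)) [1..<Suc n]"

definition core :: "nat \<Rightarrow> literal list" where
  "core n = map (\<lambda>i. (i, False)) [1..<Suc n]"

text \<open>The flag selects the side of the critical identity: \<open>False\<close> puts
  \<open>z\<close> before the core, \<open>True\<close> puts \<open>z\<^sup>*\<close> there.\<close>

definition critical_word :: "nat \<Rightarrow> bool \<Rightarrow> literal list" where
  "critical_word n b = frame n @ (0, b) # core n @ (0, \<not> b) # frame n"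

lemma length_core: "length (core n) = n"
  by (simp add: core_def)

lemma set_lift: "set (lift \<iota> \<theta> w) = (\<Union>(x, b)\<in>set w. if b then set (\<iota> (\<theta> x)) else set (\<theta> x))"
  by (induction w) auto

lemma set_sharp_word: "set (sharp_word n w) = (\<lambda>i. n + 1 - i) ` set w"
  by (simp add: sharp_word_def)

lemma word_identity_critical_word: "word_identity (critical_word n False) (critical_word n True)"
  unfolding word_identity_def
proof (intro allI impI)
  fix \<theta> :: "nat \<Rightarrow> nat list"
  assume \<theta>: "range \<theta> \<subseteq> lists (letters 3)"
  let ?s = "sharp_word 3"
  let ?z = "\<theta> 0"
  let ?f = "lift ?s \<theta> (frame n)"
  let ?m = "lift ?s \<theta> (core n)"
  have z: "?z \<in> lists (letters 3)" using \<theta> by auto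
  have eq: "lift ?s \<theta> (critical_word n False) = ?f @ (?z @ ?m @ ?s ?z) @ ?f"
    "lift ?s \<theta> (critical_word n True) = ?f @ (?s ?z @ ?m @ ?z) @ ?f"
    by (simp_all add: critical_word_def)
  have words: "?f \<in> lists (letters 3)" "?m \<in> lists (letters 3)" "?s ?z \<in> lists (letters 3)"
    using lift_sharp_word_words[OF \<theta>] sharp_word_words[OF z] by blast+
  show "(lift ?s \<theta> (critical_word n False), lift ?s \<theta> (critical_word n True)) \<in> baxter_cong 3"
  proof (cases "set ?z \<subseteq> {2}")
    case True
    then have "?z = replicate (length ?z) 2" by (intro replicate_eqI) auto
    then obtain k where "?z = replicate k 2" by blast
    then have "?s ?z = ?z" by (simp add: sharp_word_def)
    then have "lift ?s \<theta> (critical_word n False) = lift ?s \<theta> (critical_word n True)"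
      by (simp add: eq)
    then show ?thesis using baxter_cong.refl lift_sharp_word_words[OF \<theta>] by metis
  next
    case False
    have f: "set ?f = set ?z \<union> set (?s ?z) \<union> (\<Union>i\<in>{1..n}. set (?s (\<theta> i)))"
      by (auto simp: set_lift frame_def atLeastLessThanSuc_atLeastAtMost simp del: upt_Suc)
    have m: "set ?m = (\<Union>i\<in>{1..n}. set (\<theta> i))"
      by (auto simp: set_lift core_def atLeastLessThanSuc_atLeastAtMost simp del: upt_Suc)
    obtain a where a: "a \<in> set ?z" "a = 1 \<or> a = 3"
    proof -
      obtain a where a: "a \<in> set ?z" "a \<noteq> 2" using False by auto
      then have "a \<in> letters 3" using z by auto
      then have "a = 1 \<or> a = 3" using a(2) unfolding atLeastAtMost_iff by linarith
      then show thesis using that a(1) by blast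
    qed
    \<comment> \<open>The involution exchanges 1 and 3, so \<open>z\<close> and
      \<open>z\<^sup>*\<close> together supply both letters to the frame.\<close>
    then have "4 - a \<in> set (?s ?z)" by (auto simp: set_sharp_word)
    then have 13: "{1, 3} \<subseteq> set ?f" using a unfolding f by auto
    \<comment> \<open>A 2 contributed by \<open>y\<^sub>i\<close> to the core recurs in the value of
      \<open>y\<^sub>i\<^sup>*\<close> in the frame.\<close>
    have 2: "2 \<in> set (?s w)" if "2 \<in> set w" for w
      using that by (force simp: set_sharp_word)
    have "2 \<in> set ?f" if "2 \<in> set (?z @ ?m @ ?s ?z)"
      using that 2 unfolding f set_append m by blast
    then show ?thesis
      unfolding eq using z words 13 by (intro baxter_cong_middle) auto
  qed
qed

section \<open>Shape of the words identified with a critical word\<close>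

text \<open>If \<open>w\<close> began with another literal, its variable would occur once too often
  before the first \<open>a\<close>. The prefixes need to agree only up to stars because this
  invariant counts variables, not literals.\<close>

lemma word_identity_extend_prefix1:
  assumes "word_identity (p @ a # u) (p' @ w)" "map fst p = map fst p'" "a \<notin> set p" "a \<notin> set p'"
  obtains w' where "w = a # w'"
proof (cases w)
  case Nil
  then show thesis
    using mset_eq_setD[OF word_identity_mset[OF assms(1)]] assms(4) by auto
next
  case (Cons b w')
  have "a = b"
  proof (rule ccontr)
    assume "a \<noteq> b"
    have 1: "takeWhile (\<lambda>m. m \<noteq> a) (p @ a # u) = p"
      using assms(3) by (subst takeWhile_append2) auto
    have 2: "takeWhile (\<lambda>m. m \<noteq> a) (p' @ w) = p' @ b # takeWhile (\<lambda>m. m \<noteq> a) w'"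
      using assms(4) \<open>a \<noteq> b\<close> Cons by (subst takeWhile_append2) auto
    from word_identity_count_before_literal[OF assms(1), of a "fst b"] show False
      unfolding 1 2 using assms(2) by simp
  qed
  then show thesis using Cons that by blast
qed

lemma word_identity_extend_prefix:
  assumes "word_identity (p @ x @ u) (p' @ w)" "map fst p = map fst p'"
    and "distinct x" "set x \<inter> set p = {}" "set x \<inter> set p' = {}"
  obtains w' where "w = x @ w'"
  using assms
proof (induction x arbitrary: p p' w thesis)
  case Nil
  then show ?case by simp
next
  case (Cons a x)
  obtain w1 where w1: "w = a # w1"
    using word_identity_extend_prefix1[of p a "x @ u" p' w] Cons.prems by auto
  obtain w2 where "w1 = x @ w2"
    using Cons.IH[where p = "p @ [a]" and p' = "p' @ [a]" and w = w1] Cons.prems w1 by auto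
  then show ?case using w1 Cons.prems(1) by auto
qed

text \<open>The literals of the frame are distinct, and so are those of the core, which are absent
  before it; hence both are forced. The literal between them repeats one of the frame and is
  determined only up to its star.\<close>

lemma word_identity_critical_word_form:
  assumes "word_identity (critical_word n b) w" "n \<ge> 1"
  obtains c m where "w = frame n @ (0, c) # core n @ m"
proof -
  define t where "t = core n @ (0, \<not> b) # frame n"
  have id: "word_identity ([] @ frame n @ (0, b) # t) ([] @ w)"
    using assms(1) by (simp add: critical_word_def t_def)
  have "distinct (frame n)" by (auto simp: frame_def distinct_map inj_on_def)
  then obtain w1 where w1: "w = frame n @ w1"
    using word_identity_extend_prefix[OF id] by auto
  have set: "set w = set (critical_word n b)"
    using mset_eq_setD[OF word_identity_mset[OF assms(1)]] by simp
  have "length w = length (critical_word n b)"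
    using word_identity_mset[OF assms(1)] by (metis size_mset)
  then obtain d w2 where d: "w1 = d # w2" using w1 by (cases w1) (auto simp: critical_word_def)
  have "fst d = 0"
  proof (rule ccontr)
    assume nz: "fst d \<noteq> 0"
    have "d \<in> set (critical_word n b)" using set w1 d by auto
    then have i: "fst d \<in> {1..n}" using nz by (auto simp: critical_word_def frame_def core_def)
    show False
    proof (cases "snd d")
      case True
      \<comment> \<open>The starred variable of \<open>d\<close> occurs once before
        \<open>(1, False)\<close> in the critical word, but at least twice in
        \<open>w\<close>.\<close>
      have core: "core n = (1, False) # map (\<lambda>i. (i, False)) [2..<Suc n]"
        using assms(2) by (simp add: core_def upt_conv_Cons numeral_2_eq_2)
      have 1: "takeWhile (\<lambda>m. m \<noteq> (1, False)) (critical_word n b) = frame n @ [(0, b)]"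
        unfolding critical_word_def core
        by (subst takeWhile_append2) (auto simp: frame_def)
      have 2: "takeWhile (\<lambda>m. m \<noteq> (1, False)) w = frame n @ d # takeWhile (\<lambda>m. m \<noteq> (1, False)) w2"
        unfolding w1 d using True
        by (subst takeWhile_append2) (auto simp: frame_def)
      from word_identity_count_before_literal[OF assms(1), of "(1, False)" "fst d"] nz show False
        unfolding 1 2 by simp
    next
      case False
      then obtain i where d': "d = (i, False)" "i \<ge> 1" "i \<le> n" using i by (cases d) auto
      \<comment> \<open>At least three literals of \<open>z\<close> precede \<open>d\<close> in the
        critical word, but only the two of the frame do so in \<open>w\<close>.\<close>
      have 1: "takeWhile (\<lambda>m. m \<noteq> d) (critical_word n b) =
          frame n @ (0, b) # takeWhile (\<lambda>m. m \<noteq> d) t"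
        unfolding critical_word_def t_def using d'
        by (subst takeWhile_append2) (auto simp: frame_def)
      have 2: "takeWhile (\<lambda>m. m \<noteq> d) w = frame n"
        unfolding w1 d using d' by (subst takeWhile_append2) (auto simp: frame_def)
      from word_identity_count_before_literal[OF assms(1), of d 0] show False
        unfolding 1 2 by simp
    qed
  qed
  then obtain c where c: "d = (0, c)" by (cases d) auto
  have "word_identity ((frame n @ [(0, b)]) @ core n @ (0, \<not> b) # frame n)
      ((frame n @ [(0, c)]) @ w2)"
    using assms(1) by (simp add: critical_word_def w1 d c)
  moreover have "distinct (core n)" by (simp add: core_def distinct_map inj_on_def)
  moreover have "set (core n) \<inter> set (frame n @ [(0, e)]) = {}" for e
    by (auto simp: frame_def core_def)
  ultimately obtain m where "w2 = core n @ m"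
    using word_identity_extend_prefix[of "frame n @ [(0, b)]" "core n" "(0, \<not> b) # frame n"
        "frame n @ [(0, c)]" w2] by auto
  then show thesis using that w1 d c by simp
qed

section \<open>Rigidity under short identities\<close>

text \<open>There are fewer blocks than letters of \<open>m\<close>, so some block contains two
  consecutive letters of \<open>m\<close>; the last equation records their position.\<close>

lemma concat_map_pigeonhole:
  assumes "concat (map g p) = x @ m @ y" "length p < length m"
  obtains p1 h p2 m1 c d m2 s t where "p = p1 @ h # p2" "m = m1 @ c # d # m2"
    "g h = s @ c # d # t" "concat (map g p1) @ s = x @ m1"
  using assms
proof (induction p arbitrary: x m thesis)
  case Nil
  then show ?case by simp
next
  case (Cons h p)
  have gh: "g h @ concat (map g p) = x @ m @ y" using Cons.prems(2) by simp
  show ?case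
  proof (cases "length (g h) \<le> length x")
    case True
    then obtain x' where x': "x = g h @ x'"
      using gh by (metis append_eq_append_conv_if append_take_drop_id)
    then have "concat (map g p) = x' @ m @ y" "length p < length m"
      using gh Cons.prems(3) by simp_all
    from Cons.IH[OF _ this] obtain p1 h' p2 m1 c d m2 s t
      where *: "p = p1 @ h' # p2" "m = m1 @ c # d # m2"
        "g h' = s @ c # d # t" "concat (map g p1) @ s = x' @ m1" by blast
    show ?thesis by (rule Cons.prems(1)[of "h # p1" h' p2 m1 c d m2 s t]) (use * x' in simp_all)
  next
    case False
    then obtain g' where g': "g h = x @ g'" "g' \<noteq> []"
      using gh by (metis append_Nil2 append_eq_append_conv_if append_take_drop_id linear order_refl)
    then have gm: "g' @ concat (map g p) = m @ y" using gh by simp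
    obtain c m' where m': "m = c # m'" "length p < length m'" using Cons.prems(3) by (cases m) auto
    obtain t where t: "g' = c # t" using g'(2) gm m' by (cases g') auto
    show ?thesis
    proof (cases t)
      case Nil
      \<comment> \<open>The block holds only the first letter of \<open>m\<close>, so one block and
        one letter are dropped.\<close>
      then have "concat (map g p) = [] @ m' @ y" using gm m' t by simp
      from Cons.IH[OF _ this m'(2)] obtain p1 h' p2 m1 c' d m2 s t
        where *: "p = p1 @ h' # p2" "m' = m1 @ c' # d # m2"
          "g h' = s @ c' # d # t" "concat (map g p1) @ s = [] @ m1" by blast
      show ?thesis
        by (rule Cons.prems(1)[of "h # p1" h' p2 "c # m1" c' d m2 s t])
          (use * m' g' t Nil in simp_all)
    next
      case (Cons d t')
      then obtain m2 where "m' = d # m2" using gm m' t by (cases m') auto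
      then show ?thesis
        using Cons.prems(1)[of "[]" h p "[]" c d m2 x t'] g' t Cons m' by simp
    qed
  qed
qed

lemma critical_word_rigid:
  assumes "word_identity p q" "length p < n"
    and "frame n @ (0, b) # core n @ m = l @ lift word_star \<psi> p @ r"
    and "frame n @ (0, b') # core n @ m' = l @ lift word_star \<psi> q @ r"
  shows "b = b'"
proof -
  let ?w = "frame n @ (0, b) # core n @ m" and ?w' = "frame n @ (0, b') # core n @ m'"
  let ?p = "lift word_star \<psi> p" and ?q = "lift word_star \<psi> q"
  let ?k = "length (frame n)"
  have mset_pq: "mset ?p = mset ?q"
    by (rule mset_lift_cong[OF word_identity_mset[OF assms(1)]])
  then have len: "length ?p = length ?q" by (metis size_mset)
  \<comment> \<open>Up to \<open>j\<close> letters into the core the two words differ at most in the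
    literal after the frame, so the contents of these prefixes determine it.\<close>
  have cut: "b = b'" if "mset (take (Suc (?k + j)) ?w) = mset (take (Suc (?k + j)) ?w')" "j \<le> n" for j
    using that by (simp add: length_core)
  \<comment> \<open>The replaced factor starts after the critical literal, ends no later than the
    core, or covers both that literal and the core and extends beyond.\<close>
  consider "Suc ?k \<le> length l" | "length (l @ ?p) \<le> Suc (?k + n)"
    | "length l \<le> ?k" "Suc (?k + n) < length (l @ ?p)" by linarith
  then show ?thesis
  proof cases
    case 1
    show ?thesis by (rule cut[of 0]) (use 1 in \<open>simp_all add: assms(3,4)\<close>)
  next
    case 2
    show ?thesis by (rule cut[of n]) (use 2 len mset_pq in \<open>simp_all add: assms(3,4)\<close>)
  next
    case 3
    have "take (length l) (frame n) = l"
      using arg_cong[OF assms(3), of "take (length l)"] 3(1) by simp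
    then obtain f where lf: "frame n = l @ f" by (metis append_take_drop_id)
    have pr: "?p @ r = (f @ (0, b) # core n) @ m" using assms(3) lf by simp
    have "length (f @ (0, b) # core n) \<le> length ?p" using 3 lf by (simp add: length_core)
    then have "take (length (f @ (0, b) # core n)) ?p = f @ (0, b) # core n"
      using arg_cong[OF pr, of "take (length (f @ (0, b) # core n))"] by simp
    then obtain y where "?p = (f @ (0, b) # core n) @ y"
      by (metis append_take_drop_id)
    then have cover: "concat (map (\<lambda>x. if snd x then word_star (\<psi> (fst x)) else \<psi> (fst x)) p) =
        (f @ [(0, b)]) @ core n @ y" by (simp add: lift_def)
    have "length p < length (core n)" using assms(2) by (simp add: length_core)
    from concat_map_pigeonhole[OF cover this] obtain p1 h p2 m1 c d m2 s t where
      p: "p = p1 @ h # p2" and core: "core n = m1 @ c # d # m2"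
      and h: "(if snd h then word_star (\<psi> (fst h)) else \<psi> (fst h)) = s @ c # d # t"
      and cover1: "concat (map (\<lambda>x. if snd x then word_star (\<psi> (fst x)) else \<psi> (fst x)) p1) @ s =
        (f @ [(0, b)]) @ m1"
      by blast
    have p1: "lift word_star \<psi> p1 @ s = f @ (0, b) # m1"
      using cover1 by (simp add: lift_def)
    \<comment> \<open>The core is numbered from 1, so the letter after \<open>m1\<close> is the
      variable with this index.\<close>
    let ?i = "Suc (length m1)"
    have len: "?i < n" using length_core[of n] unfolding core by simp
    then have j: "length m1 \<le> n" by simp
    have "core n ! k = (Suc k, False)" if "k < n" for k
      using that by (simp add: core_def del: upt_Suc)
    from this[of "length m1"] this[of ?i]
    have cd: "c = (?i, False)" "d = (Suc ?i, False)"
      using len unfolding core by (simp_all add: nth_append)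
    have "distinct (core n)" by (simp add: core_def distinct_map inj_on_def)
    then have c: "c \<notin> set m1" by (simp add: core)
    have m1: "\<forall>x\<in>set m1. \<not> snd x"
    proof
      fix x assume "x \<in> set m1"
      then have "x \<in> set (core n)" unfolding core by simp
      then show "\<not> snd x" by (auto simp: core_def)
    qed
    have "fst h \<notin> fst ` set p1"
    proof
      assume "fst h \<in> fst ` set p1"
      then obtain b0 where "(fst h, b0) \<in> set p1" by force
      then obtain p3 p4 where "p1 = p3 @ (fst h, b0) # p4" by (meson split_list)
      then have "frame n @ (0, b) # m1 = (l @ lift word_star \<psi> p3) @
          (if b0 then word_star (\<psi> (fst h)) else \<psi> (fst h)) @ lift word_star \<psi> p4 @ s"
        using p1 lf by (cases b0) simp_all
      then obtain u1 u2 where u: "frame n @ (0, b) # m1 =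
          u1 @ (if b0 then word_star (\<psi> (fst h)) else \<psi> (fst h)) @ u2"
        by blast
      show False
      proof (cases "b0 = snd h")
        \<comment> \<open>An earlier copy of \<open>h\<close> would bring an unstarred
          \<open>c\<close> before the core reaches it.\<close>
        case True
        then have "c \<in> set (frame n @ (0, b) # m1)" using u h by simp
        then show False using c by (auto simp: cd frame_def)
      next
        case False
        have "(if b0 then word_star (\<psi> (fst h)) else \<psi> (fst h)) =
            word_star (if snd h then word_star (\<psi> (fst h)) else \<psi> (fst h))"
          using False by simp
        also have "\<dots> = word_star t @ [(Suc ?i, True), (?i, True)] @ word_star s"
          unfolding h by (simp add: cd)
        finally have eq: "frame n @ (0, b) # m1 =
            u1 @ word_star t @ [(Suc ?i, True), (?i, True)] @ word_star s @ u2"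
          using u by simp
        \<comment> \<open>The starred variables other than \<open>z\<close> appear in increasing
          order in this prefix, whereas an earlier opposite copy of \<open>h\<close> would create a
          descent.\<close>
        have "filter (\<lambda>x. snd x \<and> fst x \<noteq> 0) m1 = []" using m1 by (simp add: filter_empty_conv)
        then have "map fst (filter (\<lambda>x. snd x \<and> fst x \<noteq> 0) (frame n @ (0, b) # m1)) = [1..<Suc n]"
          by (simp add: frame_def filter_map comp_def del: upt_Suc)
        then have "sorted (map fst (filter (\<lambda>x. snd x \<and> fst x \<noteq> 0) (frame n @ (0, b) # m1)))"
          by (simp del: upt_Suc)
        then show False unfolding eq by (simp add: sorted_append)
      qed
    qed
    \<comment> \<open>Hence \<open>q\<close> too has a rearrangement of \<open>p1\<close> in front
      of its first \<open>h\<close>, and the parts of the two words before \<open>c\<close> have the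
      same content.\<close>
    from word_identity_first_literal[OF assms(1)[unfolded p] this] obtain q1 q2
      where q: "q = q1 @ h # q2" "mset p1 = mset q1" by blast
    have mset1: "mset (lift word_star \<psi> p1) = mset (lift word_star \<psi> q1)"
      by (rule mset_lift_cong[OF q(2)])
    then have len1: "length (lift word_star \<psi> p1) = length (lift word_star \<psi> q1)"
      by (metis size_mset)
    have len2: "Suc (?k + length m1) = length (l @ lift word_star \<psi> p1 @ s)"
      unfolding p1 by (simp add: lf)
    have "?w = (l @ lift word_star \<psi> p1 @ s) @ c # d # t @ lift word_star \<psi> p2 @ r"
      "?w' = (l @ lift word_star \<psi> q1 @ s) @ c # d # t @ lift word_star \<psi> q2 @ r"
      using h by (simp_all add: assms(3,4) p q(1))
    then have "take (Suc (?k + length m1)) ?w = l @ lift word_star \<psi> p1 @ s"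
      "take (Suc (?k + length m1)) ?w' = l @ lift word_star \<psi> q1 @ s"
      unfolding len2 using len1 by simp_all
    then show ?thesis using mset1 by (intro cut[OF _ j]) simp
  qed
qed

theorem theorem5p5: "\<not> finitely_based (baxt 3) (sharp 3)"
proof
  assume "finitely_based (baxt 3) (sharp 3)"
  then obtain \<Sigma> where fin: "finite \<Sigma>" and basis: "identity_basis \<Sigma> (baxt 3) (sharp 3)"
    by (auto simp: finitely_based_def)
  \<comment> \<open>Summing over the finite basis bounds the length of every side at once.\<close>
  define N where "N = (\<Sum>(p, q)\<in>\<Sigma>. length (trm_word p) + length (trm_word q))"
  define n where "n = Suc N"
  have short: "length (trm_word p) < n" "length (trm_word q) < n" if "(p, q) \<in> \<Sigma>" for p q
    using member_le_sum[OF that, of "\<lambda>(p, q). length (trm_word p) + length (trm_word q)"] fin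
    by (simp_all add: n_def N_def)
  have sound: "word_identity (trm_word p) (trm_word q)" if "(p, q) \<in> \<Sigma>" for p q
    using that basis unfolding identity_basis_def by (metis identities_baxt_iff subsetD)
  let ?s = "word_trm (critical_word n False)" and ?t = "word_trm (critical_word n True)"
  \<comment> \<open>The property preserved along a deduction; the right side of the critical
    identity violates it, having \<open>z\<^sup>*\<close> after the frame.\<close>
  define good where "good = (\<lambda>w. word_identity (critical_word n False) w \<and>
    (\<exists>m. w = frame n @ (0, False) # core n @ m))"
  have good_step: "good (trm_word t)"
    if s: "good (trm_word s)" and pq: "directly_deducible (p, q) s t"
      "word_identity (trm_word p) (trm_word q)" "length (trm_word p) < n" for s t p q
  proof -
    from pq obtain l r p' q' \<psi> where w: "word_identity p' q'" "length p' < n"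
      "trm_word s = l @ lift word_star \<psi> p' @ r" "trm_word t = l @ lift word_star \<psi> q' @ r"
      by (metis directly_deducible_word)
    have id: "word_identity (critical_word n False) (trm_word t)"
      using s word_identity_lift[OF w(1)] word_identity_trans unfolding good_def w(3,4)
      by blast
    then obtain b m where t: "trm_word t = frame n @ (0, b) # core n @ m"
      using word_identity_critical_word_form by (metis n_def le_add1 plus_1_eq_Suc)
    moreover obtain m' where "trm_word s = frame n @ (0, False) # core n @ m'"
      using s unfolding good_def by blast
    ultimately have "False = b"
      using critical_word_rigid[OF w(1,2)] w(3,4) by metis
    then show ?thesis using id t unfolding good_def by blast
  qed
  have "(?s, ?t) \<in> identities (baxt 3) (sharp 3)"
    unfolding identities_baxt_iff trm_word_word_trm
    using word_identity_critical_word by (auto simp: word_trm_def critical_word_def)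
  then have "deducible \<Sigma> ?s ?t" using basis by (auto simp: identity_basis_def)
  then have "good (trm_word ?t)"
    unfolding deducible_def
  proof (induction rule: rtranclp_induct)
    case base
    have "word_identity (critical_word n False) (critical_word n False)"
      using word_identity_trans word_identity_sym word_identity_critical_word by blast
    then show ?case by (simp add: good_def) (simp add: critical_word_def)
  next
    case (step t u)
    then obtain p q where "(p, q) \<in> \<Sigma>"
      "directly_deducible (p, q) t u \<or> directly_deducible (q, p) t u" by blast
    then show ?case
      using step.IH good_step short sound word_identity_sym
      by metis
  qed
  then show False by (simp add: good_def) (simp add: critical_word_def)
qed

end
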